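(* Let $f\in\mathcal{F}$, i.e. $f$ is a real-valued function whose domain contains $\mathbb{N}$ such that $f(0)=0$, $f(k+2)-f(k+1)>f(k+1)-f(k)$ for all $k\in\mathbb{N}$, and $(k-2)f(k)\ge k\,(f(k-1)-f(1))$ for all integers $k\ge 3$. Then for all integers $n\geq 1$ and $m$ with $0\le m\le n-1$, the quasi-star graph $QS(n,m)$ maximizes $\Sigma_f$ over $\mathbb{G}(n,m)$. More precisely: (i) if $m\neq 3$ or $f(3)>3(f(2)-f(1))$, then $QS(n,m)$ uniquely maximizes $\Sigma_f$ over $\mathbb{G}(n,m)$; (ii) if $f(3)=3(f(2)-f(1))$, then $K_3\oplus\overline{K}_{n-3}$ also maximizes $\Sigma_f$ over $\mathbb{G}(n,3)$ for every $n\ge 4$.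
   Context: $\mathbb{N}=\{0,1,2,\dots\}$. Graphs are finite and simple, with vertex set $\{1,\dots,n\}$; $\mathbb{G}(n,m)$ is the set of graphs with $n$ vertices and $m$ edges. For a graph with degree sequence $d=(d_1,\dots,d_n)$, $\Sigma_f(d)=\sum_{i=1}^n f(d_i)$. A graph $G\in\mathbb{G}(n,m)$ maximizes $\Sigma_f$ over $\mathbb{G}(n,m)$ if its degree sequence attains the maximum of $\Sigma_f$ among all degree sequences of graphs in $\mathbb{G}(n,m)$; it uniquely maximizes $\Sigma_f$ if moreover, up to isomorphism, it is the only graph in $\mathbb{G}(n,m)$ that does so. $QK(n,m)$ is the graph on $\{1,\dots,n\}$ such that, with $q,r$ the unique integers satisfying $m=\binom q2+r$, $0\le r\le q-1$, the vertices $1,\dots,q$ induce a complete graph, vertex $q+1$ is adjacent exactly to $1,\dots,r$, and vertices $q+2,\dots,n$ are isolated. $QS(n,m)$ is the complement of $QK(n,\binom n2-m)$; when $m\le n-1$ it is isomorphic to $K_{1,m}$ together with $n-m-1$ isolated vertices. $G\oplus H$ is the disjoint union of $G$ and $H$, and $\overline{G}$ is the complement of $G$ (so $\overline{K}_{s}$ consists of $s$ isolated vertices). *)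

theory Defs
  imports Complex_Main
begin

text \<open>Only the values of \<open>f\<close> on the natural numbers matter, so \<open>f\<close> is represented by
  its restriction to \<open>nat\<close>.\<close>

definition class_F :: "(nat \<Rightarrow> real) set" where
  "class_F = {f. f 0 = 0
     \<and> (\<forall>k. f (k + 2) - f (k + 1) > f (k + 1) - f k)
     \<and> (\<forall>k\<ge>3. (real k - 2) * f k \<ge> real k * (f (k - 1) - f 1))}"

definition pairs :: "nat set \<Rightarrow> nat set set" where
  "pairs V = {e. e \<subseteq> V \<and> card e = 2}"

text \<open>\<open>Graph n E\<close> has vertex set \<open>{1..n}\<close>; that \<open>E\<close> consists of two-element subsets of
  \<open>{1..n}\<close> is imposed by membership in \<open>graphs n m\<close>.\<close>

datatype graph = Graph (order: nat) (edges: "nat set set")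

definition verts :: "graph \<Rightarrow> nat set" where
  "verts G = {1..order G}"

definition graphs :: "nat \<Rightarrow> nat \<Rightarrow> graph set" where
  "graphs n m = {G. order G = n \<and> edges G \<subseteq> pairs (verts G) \<and> card (edges G) = m}"

definition isomorphic :: "graph \<Rightarrow> graph \<Rightarrow> bool" where
  "isomorphic G H \<longleftrightarrow> (\<exists>\<pi>. bij_betw \<pi> (verts G) (verts H) \<and>
     (\<forall>u\<in>verts G. \<forall>v\<in>verts G. {u, v} \<in> edges G \<longleftrightarrow> {\<pi> u, \<pi> v} \<in> edges H))"

definition complement :: "graph \<Rightarrow> graph" where
  "complement G = Graph (order G) (pairs (verts G) - edges G)"

definition complete_graph :: "nat \<Rightarrow> graph" where
  "complete_graph n = Graph n (pairs {1..n})"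

text \<open>The vertices of the second graph are shifted past those of the first.\<close>

definition disjoint_union :: "graph \<Rightarrow> graph \<Rightarrow> graph" where
  "disjoint_union G H =
     Graph (order G + order H) (edges G \<union> (\<lambda>e. (\<lambda>v. order G + v) ` e) ` edges H)"

definition degree :: "graph \<Rightarrow> nat \<Rightarrow> nat" where
  "degree G v = card {e \<in> edges G. v \<in> e}"

definition degree_seq :: "graph \<Rightarrow> nat list" where
  "degree_seq G = map (degree G) [1..<order G + 1]"

definition Sigma_f :: "(nat \<Rightarrow> real) \<Rightarrow> nat list \<Rightarrow> real" where
  "Sigma_f f d = (\<Sum>i<length d. f (d ! i))"

definition maximizes :: "(nat \<Rightarrow> real) \<Rightarrow> nat \<Rightarrow> nat \<Rightarrow> graph \<Rightarrow> bool" where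
  "maximizes f n m G \<longleftrightarrow> G \<in> graphs n m \<and>
     (\<forall>d \<in> degree_seq ` graphs n m. Sigma_f f d \<le> Sigma_f f (degree_seq G))"

definition uniquely_maximizes :: "(nat \<Rightarrow> real) \<Rightarrow> nat \<Rightarrow> nat \<Rightarrow> graph \<Rightarrow> bool" where
  "uniquely_maximizes f n m G \<longleftrightarrow> maximizes f n m G \<and>
     (\<forall>H. maximizes f n m H \<longrightarrow> isomorphic G H)"

text \<open>The condition \<open>0 \<le> r \<le> q - 1\<close> over the integers is \<open>r < q\<close> over \<open>nat\<close>; in particular
  \<open>q \<ge> 1\<close>, and \<open>m = 0\<close> gives \<open>(q, r) = (1, 0)\<close>.\<close>

lemma qk_params_unique: "\<exists>!(q, r). m = (q choose 2) + r \<and> r < q"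
proof -
  have ex: "\<exists>q r. m = (q choose 2) + r \<and> r < q"
  proof (induction m)
    case 0
    have "0 = (1 choose 2) + 0 \<and> (0::nat) < 1" by simp
    then show ?case by blast
  next
    case (Suc m)
    then obtain q r where qr: "m = (q choose 2) + r" "r < q" by blast
    show ?case
    proof (cases "Suc r < q")
      case True
      then have "Suc m = (q choose 2) + Suc r \<and> Suc r < q" using qr by simp
      then show ?thesis by blast
    next
      case False
      then have "q = Suc r" using qr by simp
      then have "Suc m = (Suc q choose 2) + 0 \<and> 0 < Suc q"
        using qr by (simp add: numeral_2_eq_2)
      then show ?thesis by blast
    qed
  qed
  have less: "(q choose 2) + r < (q' choose 2) + r'" if "r < q" "q < q'" for q r q' r' :: nat
  proof -
    have "(q choose 2) + r < (Suc q choose 2)" using that by (simp add: numeral_2_eq_2)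
    also have "\<dots> \<le> (q' choose 2)" using that by (intro binomial_right_mono) simp
    finally show ?thesis by simp
  qed
  have uniq: "q = q' \<and> r = r'"
    if "m = (q choose 2) + r" "r < q" "m = (q' choose 2) + r'" "r' < q'" for q r q' r'
    using less[of r q q' r'] less[of r' q' q r] that by (cases q q' rule: linorder_cases) auto
  obtain q r where qr: "m = (q choose 2) + r" "r < q" using ex by blast
  show ?thesis
  proof (rule ex1I[of _ "(q, r)"])
    show "case (q, r) of (q, r) \<Rightarrow> m = (q choose 2) + r \<and> r < q" using qr by simp
  next
    fix p assume "case p of (q, r) \<Rightarrow> m = (q choose 2) + r \<and> r < q"
    then show "p = (q, r)" using uniq[OF _ _ qr] by (cases p) auto
  qed
qed

definition qk_params :: "nat \<Rightarrow> nat \<times> nat" where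
  "qk_params m = (THE (q, r). m = (q choose 2) + r \<and> r < q)"

text \<open>For \<open>m \<le> n choose 2\<close>, all edges below lie inside \<open>{1..n}\<close>.\<close>

definition QK :: "nat \<Rightarrow> nat \<Rightarrow> graph" where
  "QK n m = (case qk_params m of (q, r) \<Rightarrow>
     Graph n (pairs {1..q} \<union> {{i, q + 1} | i. i \<in> {1..r}}))"

definition QS :: "nat \<Rightarrow> nat \<Rightarrow> graph" where
  "QS n m = complement (QK n ((n choose 2) - m))"

end

theory Submission
  imports Defs
begin

text \<open>Put \<open>g k = f k / k\<close>. Since \<open>f 0 = 0\<close>, double counting turns \<open>\<Sigma>\<^sub>f\<close> into the sum over
  all edges \<open>uv\<close> of \<open>g (d u) + g (d v)\<close>. Strict convexity makes \<open>g\<close> strictly increasing, and the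
  third condition on \<open>f\<close> says that \<open>(g k - g 1) / (k - 1)\<close> is nondecreasing; such a function is
  superadditive in \<open>k - 1\<close>, so \<open>g a + g b \<le> g (a + b - 1) + g 1\<close>. As \<open>d u + d v \<le> m + 1\<close> for
  an edge \<open>uv\<close>, every edge contributes at most \<open>g m + g 1\<close>, which is what each edge of a star
  with \<open>m\<close> edges contributes. Equality forces \<open>d u + d v = m + 1\<close> for all edges, so any two edges
  meet, and the graph is a star or a triangle.\<close>

section \<open>The class of functions\<close>

text \<open>For positive \<open>i\<close> and \<open>j\<close> the ratios at both are at most the
  ratio \<open>s\<close> at \<open>i + j\<close>, so \<open>h i + h j\<close> is at most
  \<open>(i + j) * s\<close>, which is \<open>h (i + j)\<close>. An argument 0 is covered by
  \<open>h 0 = 0\<close>.\<close>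

lemma superadditive_if_ratio_mono:
  fixes h :: "nat \<Rightarrow> real"
  assumes "h 0 = 0" and step: "\<And>k. k \<ge> 1 \<Longrightarrow> h k / k \<le> h (Suc k) / Suc k"
  shows "h i + h j \<le> h (i + j)"
proof (cases "i = 0 \<or> j = 0")
  case False
  have mono: "h k / k \<le> h l / l" if "1 \<le> k" "k \<le> l" for k l
    using that(2)
  proof (induction l rule: dec_induct)
    case (step l)
    then show ?case using assms(2)[of l] that(1) by (meson le_trans order_trans)
  qed simp
  define s where "s = h (i + j) / (i + j)"
  have "h i \<le> i * s" "h j \<le> j * s"
    using mono[of i "i + j"] mono[of j "i + j"] False
    by (auto simp: s_def field_simps)
  moreover have "h (i + j) = i * s + j * s"
  proof -
    have "h (i + j) = (real i + real j) * s" using False by (simp add: s_def)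
    then show ?thesis by (simp only: distrib_right)
  qed
  ultimately show ?thesis by linarith
qed (use assms in auto)

text \<open>The \<open>g\<close> of the outline: the share of \<open>f k\<close> that a vertex of
  degree \<open>k\<close> gives to each incident edge. At \<open>k = 0\<close> division by zero
  yields 0.\<close>

definition quot :: "(nat \<Rightarrow> real) \<Rightarrow> nat \<Rightarrow> real" where
  "quot f k = f k / real k"

lemma mult_quot:
  assumes "f 0 = 0"
  shows "real k * quot f k = f k"
  using assms by (cases "k = 0") (auto simp: quot_def)

text \<open>Clearing denominators leaves \<open>f k < k * (f (Suc k) - f k)\<close>:
  \<open>f k\<close> is the sum of the first \<open>k\<close> increments, each smaller than the next
  increment by strict convexity.\<close>

lemma class_F_quot_less_Suc:
  assumes "f \<in> class_F" "k \<ge> 1"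
  shows "quot f k < quot f (Suc k)"
proof -
  have convex: "f (k + 2) - f (k + 1) > f (k + 1) - f k" and "f 0 = 0" for k
    using assms by (auto simp: class_F_def)
  have "f k < k * (f (Suc k) - f k)" using assms(2)
  proof (induction k rule: dec_induct)
    case base
    then show ?case using convex[of 0] \<open>f 0 = 0\<close> by (simp add: numeral_2_eq_2)
  next
    case (step k)
    have "f (Suc k) < Suc k * (f (Suc k) - f k)"
      using step.IH by (simp add: algebra_simps)
    also have "\<dots> \<le> Suc k * (f (Suc (Suc k)) - f (Suc k))"
      using convex[of k] by (intro mult_left_mono) auto
    finally show ?case .
  qed
  then show ?thesis using assms(2) by (simp add: quot_def field_simps)
qed

lemma class_F_quot_mono:
  assumes "f \<in> class_F" "1 \<le> k" "k \<le> l"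
  shows "quot f k \<le> quot f l"
  using assms(3)
proof (induction l rule: dec_induct)
  case (step l)
  then show ?case using class_F_quot_less_Suc[OF assms(1), of l] assms(2) by linarith
qed simp

text \<open>The shift \<open>?h\<close> vanishes at 0 and the third condition on \<open>f\<close>
  makes \<open>?h k / k\<close> nondecreasing, so \<open>?h\<close> is superadditive; adding
  \<open>2 * quot f 1\<close> gives the claim.\<close>

lemma class_F_quot_add_le:
  assumes "f \<in> class_F"
  shows "quot f (Suc i) + quot f (Suc j) \<le> quot f (Suc (i + j)) + quot f 1"
proof -
  let ?h = "\<lambda>k. quot f (Suc k) - quot f 1"
  have "?h k / k \<le> ?h (Suc k) / Suc k" if "k \<ge> 1" for k
  proof -
    define x where "x = real k"
    have "x > 0" using that by (simp add: x_def)
    have "(real (k + 2) - 2) * f (k + 2) \<ge> real (k + 2) * (f (k + 2 - 1) - f 1)"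
    proof -
      have "3 \<le> k + 2" using that by simp
      then show ?thesis using assms unfolding class_F_def by blast
    qed
    then have le: "(x + 2) * (f (Suc k) - f 1) \<le> x * f (Suc (Suc k))"
      by (simp add: x_def algebra_simps)
    \<comment> \<open>Over the common denominator \<open>x * (x + 1) * (x + 2)\<close>, comparing
      the numerators of the two ratios amounts exactly to \<open>le\<close>.\<close>
    have "?h k / k = (x + 2) * (f (Suc k) - f 1 * (x + 1)) / (x * (x + 1) * (x + 2))"
      using \<open>x > 0\<close> by (simp add: quot_def x_def divide_simps) (simp add: algebra_simps)
    also have "\<dots> \<le> x * (f (Suc (Suc k)) - f 1 * (x + 2)) / (x * (x + 1) * (x + 2))"
      using le \<open>x > 0\<close> by (intro divide_right_mono) (auto simp: algebra_simps)
    also have "\<dots> = ?h (Suc k) / Suc k"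
      using \<open>x > 0\<close> by (simp add: quot_def x_def divide_simps) (simp add: algebra_simps)
    finally show ?thesis .
  qed
  from superadditive_if_ratio_mono[of ?h, OF _ this, of i j] show ?thesis by simp
qed

section \<open>Edge sums\<close>

definition edge_weight :: "(nat \<Rightarrow> real) \<Rightarrow> graph \<Rightarrow> nat set \<Rightarrow> real" where
  "edge_weight f G e = (\<Sum>v\<in>e. quot f (degree G v))"

lemma graphsD:
  assumes "G \<in> graphs n m"
  shows "verts G = {1..n}" "card (edges G) = m" "finite (edges G)"
    and "\<And>e. e \<in> edges G \<Longrightarrow> e \<subseteq> {1..n}" "\<And>e. e \<in> edges G \<Longrightarrow> card e = 2"
proof -
  have sub: "edges G \<subseteq> pairs {1..n}" and "card (edges G) = m" and "verts G = {1..n}"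
    using assms by (auto simp: graphs_def verts_def)
  then show "verts G = {1..n}" "card (edges G) = m"
    "\<And>e. e \<in> edges G \<Longrightarrow> e \<subseteq> {1..n}" "\<And>e. e \<in> edges G \<Longrightarrow> card e = 2"
    by (auto simp: pairs_def)
  have "pairs {1..n} \<subseteq> Pow {1..n}" by (auto simp: pairs_def)
  then show "finite (edges G)" using sub by (meson finite_Pow_iff finite_atLeastAtMost finite_subset)
qed

lemma Sigma_f_eq_sum_degree: "Sigma_f f (degree_seq G) = (\<Sum>v\<in>verts G. f (degree G v))"
proof -
  have "Sigma_f f (degree_seq G) = (\<Sum>i<order G. f (degree G (Suc i)))"
    by (simp add: Sigma_f_def degree_seq_def nth_append del: upt_Suc)
  also have "\<dots> = (\<Sum>v\<in>verts G. f (degree G v))"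
    by (simp add: verts_def sum.atLeast1_atMost_eq)
  finally show ?thesis .
qed

text \<open>Double counting of incidences: each vertex spreads its value evenly over its edges.
  Isolated vertices have no edge to carry a value, whence \<open>f 0 = 0\<close>.\<close>

lemma Sigma_f_eq_sum_edges:
  assumes "f 0 = 0" "G \<in> graphs n m"
  shows "Sigma_f f (degree_seq G) = (\<Sum>e\<in>edges G. edge_weight f G e)"
proof -
  note G = graphsD[OF assms(2)]
  have "Sigma_f f (degree_seq G)
      = (\<Sum>v\<in>{1..n}. \<Sum>e\<in>{e\<in>edges G. v \<in> e}. quot f (degree G v))"
    by (simp add: Sigma_f_eq_sum_degree G(1) degree_def mult_quot[of f, OF assms(1)])
  also have "\<dots> = (\<Sum>e\<in>edges G. \<Sum>v\<in>{v\<in>{1..n}. v \<in> e}. quot f (degree G v))"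
    by (rule sum.swap_restrict) (use G in auto)
  also have "\<dots> = (\<Sum>e\<in>edges G. edge_weight f G e)"
    unfolding edge_weight_def
  proof (rule sum.cong[OF refl])
    fix e assume "e \<in> edges G"
    then have "{v\<in>{1..n}. v \<in> e} = e" using G(4) by blast
    then show "(\<Sum>v\<in>{v\<in>{1..n}. v \<in> e}. quot f (degree G v)) = (\<Sum>v\<in>e. quot f (degree G v))"
      by simp
  qed
  finally show ?thesis .
qed

text \<open>Inclusion-exclusion: only the edge \<open>{u, v}\<close> itself contains both ends, so
  it alone is counted twice.\<close>

lemma degree_add_degree:
  assumes "finite (edges G)" "{u, v} \<in> edges G" "\<And>e. e \<in> edges G \<Longrightarrow> card e = 2" "u \<noteq> v"
  shows "degree G u + degree G v = card {e \<in> edges G. u \<in> e \<or> v \<in> e} + 1"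
proof -
  have "e = {u, v}" if "e \<in> edges G" "u \<in> e" "v \<in> e" for e
    using assms(3)[OF that(1)] that assms(4) by (auto simp: card_2_iff)
  then have "{e \<in> edges G. u \<in> e} \<inter> {e \<in> edges G. v \<in> e} = {{u, v}}"
    using assms(2) by blast
  moreover have "{e \<in> edges G. u \<in> e} \<union> {e \<in> edges G. v \<in> e} = {e \<in> edges G. u \<in> e \<or> v \<in> e}"
    by auto
  ultimately show ?thesis
    using card_Un_Int[of "{e \<in> edges G. u \<in> e}" "{e \<in> edges G. v \<in> e}"] assms(1)
    by (simp add: degree_def)
qed

lemma degree_pos:
  assumes "finite (edges G)" "e \<in> edges G" "v \<in> e"
  shows "degree G v \<ge> 1"
  using assms by (auto simp: degree_def Suc_le_eq card_gt_0_iff)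

text \<open>If the ends of \<open>e\<close> have degrees \<open>i + 1\<close> and
  \<open>j + 1\<close>, then \<open>i + j + 1\<close> edges meet \<open>e\<close>, and this number
  is at most \<open>m\<close>. Superadditivity and monotonicity of \<open>quot f\<close> give the
  bound.\<close>

lemma edge_weight_le:
  assumes "f \<in> class_F" "G \<in> graphs n m" "e \<in> edges G"
  shows "edge_weight f G e \<le> quot f m + quot f 1"
    and "edge_weight f G e = quot f m + quot f 1 \<Longrightarrow> e' \<in> edges G \<Longrightarrow> e \<inter> e' \<noteq> {}"
proof -
  note G = graphsD[OF assms(2)]
  obtain u v where uv: "e = {u, v}" "u \<noteq> v" using G(5)[OF assms(3)] by (auto simp: card_2_iff)
  let ?S = "{e \<in> edges G. u \<in> e \<or> v \<in> e}"
  have "degree G u \<ge> 1" "degree G v \<ge> 1"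
    using degree_pos[OF G(3) assms(3)] uv by auto
  then obtain i j where ij: "degree G u = Suc i" "degree G v = Suc j"
    by (metis One_nat_def Suc_le_D)
  have S: "card ?S = Suc (i + j)"
    using degree_add_degree[OF G(3), of u v] G(5) assms(3) uv ij by simp
  have le: "card ?S \<le> m" using G(2,3) card_mono[of "edges G" ?S] by auto
  have w: "edge_weight f G e \<le> quot f (card ?S) + quot f 1"
    using class_F_quot_add_le[OF assms(1), of i j] by (simp add: edge_weight_def uv ij S)
  also have "\<dots> \<le> quot f m + quot f 1"
    using class_F_quot_mono[OF assms(1), of "card ?S" m] S le by simp
  finally show "edge_weight f G e \<le> quot f m + quot f 1" .
  show "e \<inter> e' \<noteq> {}" if eq: "edge_weight f G e = quot f m + quot f 1" and e': "e' \<in> edges G"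
  proof -
    \<comment> \<open>If some edge missed \<open>e\<close>, the strict increase of
      \<open>quot f\<close> would put the weight below the bound.\<close>
    have "card ?S = m"
    proof (rule ccontr)
      assume "card ?S \<noteq> m"
      then have "quot f (Suc (card ?S)) \<le> quot f m"
        using class_F_quot_mono[OF assms(1), of "Suc (card ?S)" m] le by simp
      then show False using class_F_quot_less_Suc[OF assms(1), of "card ?S"] S w eq by simp
    qed
    then have "?S = edges G" using G(2,3) by (intro card_subset_eq) auto
    then show ?thesis using e' uv by auto
  qed
qed

text \<open>The bound per edge, taken \<open>m\<close> times, is the value of a star:
  \<open>f m\<close> from the centre and \<open>f 1\<close> from each of \<open>m\<close>
  leaves.\<close>

lemma card_mult_quot_add:
  assumes "f 0 = 0"
  shows "real m * (quot f m + quot f 1) = f m + real m * f 1"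
  using mult_quot[of f, OF assms, of m] mult_quot[of f, OF assms, of 1] by (simp add: distrib_left)

text \<open>Sum the bound over the \<open>m\<close> edges. Equality of the sums forces equality at
  every edge, and then any two edges meet.\<close>

lemma Sigma_f_le:
  assumes "f \<in> class_F" "G \<in> graphs n m"
  shows "Sigma_f f (degree_seq G) \<le> f m + real m * f 1"
    and "Sigma_f f (degree_seq G) = f m + real m * f 1 \<Longrightarrow>
      e \<in> edges G \<Longrightarrow> e' \<in> edges G \<Longrightarrow> e \<inter> e' \<noteq> {}"
proof -
  note G = graphsD[OF assms(2)]
  have f0: "f 0 = 0" using assms(1) by (simp add: class_F_def)
  let ?B = "quot f m + quot f 1"
  have B: "(\<Sum>e\<in>edges G. ?B) = f m + real m * f 1"
    using card_mult_quot_add[of f, OF f0, of m] by (simp add: G(2))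
  note w = edge_weight_le(1)[OF assms]
  show "Sigma_f f (degree_seq G) \<le> f m + real m * f 1"
    unfolding Sigma_f_eq_sum_edges[of f, OF f0 assms(2)] B[symmetric] by (rule sum_mono) (rule w)
  assume eq: "Sigma_f f (degree_seq G) = f m + real m * f 1"
    and e: "e \<in> edges G" and e': "e' \<in> edges G"
  have "edge_weight f G e = ?B"
    by (rule sum_mono_inv[OF _ w e G(3)])
      (use eq B Sigma_f_eq_sum_edges[of f, OF f0 assms(2)] in simp)
  then show "e \<inter> e' \<noteq> {}" using edge_weight_le(2)[OF assms e _ e'] by simp
qed

section \<open>Stars and triangles\<close>

text \<open>Fix an edge \<open>{a, b}\<close>. Unless \<open>a\<close> or \<open>b\<close> lies in
  all edges, one edge avoids \<open>a\<close> and another avoids \<open>b\<close>; meeting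
  \<open>{a, b}\<close> and each other, they close a triangle.\<close>

lemma intersecting_pairs_cases:
  assumes card2: "\<And>e. e \<in> E \<Longrightarrow> card e = 2"
    and inter: "\<And>e e'. e \<in> E \<Longrightarrow> e' \<in> E \<Longrightarrow> e \<inter> e' \<noteq> {}"
    and "E \<noteq> {}"
  obtains (star) c where "\<And>e. e \<in> E \<Longrightarrow> c \<in> e"
  | (triangle) a b c where "distinct [a, b, c]" "E = {{a, b}, {b, c}, {a, c}}"
proof -
  obtain a b where ab: "{a, b} \<in> E" "a \<noteq> b"
    using assms(3) card2 by (metis card_2_iff ex_in_conv)
  consider "\<forall>e\<in>E. a \<in> e" | "\<forall>e\<in>E. b \<in> e"
    | e e' where "e \<in> E" "a \<notin> e" "e' \<in> E" "b \<notin> e'" by blast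
  then show thesis
  proof cases
    case 3
    have "b \<in> e" "a \<in> e'" using inter[OF ab(1) 3(1)] inter[OF ab(1) 3(3)] 3 by auto
    then obtain c d where "e = {b, c}" "b \<noteq> c" "e' = {a, d}" "a \<noteq> d"
      using card2[OF 3(1)] card2[OF 3(3)] by (auto simp: card_2_iff)
    moreover from this have "c = d" using inter[OF 3(1) 3(3)] 3 by auto
    ultimately have c: "{b, c} \<in> E" "{a, c} \<in> E" "distinct [a, b, c]"
      using 3 ab by auto
    \<comment> \<open>A pair with at most one vertex in the triangle would miss one of its
      sides.\<close>
    have "x \<in> {{a, b}, {b, c}, {a, c}}" if x: "x \<in> E" for x
    proof -
      obtain p q where "x = {p, q}" using card2[OF x] by (auto simp: card_2_iff)
      then show ?thesis using inter[OF x ab(1)] inter[OF x c(1)] inter[OF x c(2)] c(3)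
        by auto
    qed
    then show thesis using triangle[OF c(3)] ab c by auto
  qed (use star in auto)
qed

text \<open>Each side joins two vertices of degree 2 and so has weight \<open>f 2\<close>. The total
  equals the bound \<open>f 3 + 3 * f 1\<close> exactly when
  \<open>f 3 = 3 * (f 2 - f 1)\<close>.\<close>

lemma Sigma_f_triangle:
  assumes "f 0 = 0" "G \<in> graphs n m" "distinct [a, b, c]" "edges G = {{a, b}, {b, c}, {a, c}}"
  shows "m = 3" "Sigma_f f (degree_seq G) = 3 * f 2"
proof -
  have neq: "{a, b} \<noteq> {b, c}" "{a, b} \<noteq> {a, c}" "{b, c} \<noteq> {a, c}"
    using assms(3) by (auto simp: doubleton_eq_iff)
  have "{e \<in> edges G. a \<in> e} = {{a, b}, {a, c}}" "{e \<in> edges G. b \<in> e} = {{a, b}, {b, c}}"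
    "{e \<in> edges G. c \<in> e} = {{b, c}, {a, c}}"
    using assms(3) unfolding assms(4) by auto
  then have "degree G a = 2" "degree G b = 2" "degree G c = 2"
    using neq by (simp_all add: degree_def)
  then show "Sigma_f f (degree_seq G) = 3 * f 2"
    unfolding Sigma_f_eq_sum_edges[of f, OF assms(1,2)] assms(4)
    using neq assms(3) by (simp add: edge_weight_def quot_def)
  show "m = 3" using graphsD(2)[OF assms(2)] neq by (simp add: assms(4))
qed

text \<open>Vertices outside \<open>L\<close> other than \<open>c\<close> are isolated.
  \<open>L\<close> may be empty, so an edgeless graph is a star around any of its vertices; this
  covers \<open>m = 0\<close>.\<close>

definition is_star :: "graph \<Rightarrow> nat \<Rightarrow> nat set \<Rightarrow> bool" where
  "is_star G c L \<longleftrightarrow> c \<in> verts G \<and> L \<subseteq> verts G - {c} \<and> edges G = (\<lambda>x. {c, x}) ` L"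

lemma inj_on_doubleton: "inj_on (\<lambda>x. {c, x}) L"
  by (auto simp: inj_on_def doubleton_eq_iff)

lemma is_star_card:
  assumes "is_star G c L"
  shows "card (edges G) = card L"
  using assms inj_on_doubleton[of c L] by (simp add: is_star_def card_image)

lemma is_star_in_graphs:
  assumes "is_star G c L" "order G = n"
  shows "G \<in> graphs n (card L)"
  using assms is_star_card[OF assms(1)] by (auto simp: graphs_def is_star_def pairs_def card_insert_if)

text \<open>Every edge joins the centre, of degree \<open>card L\<close>, to a leaf of degree 1, so
  each edge attains the bound on its weight.\<close>

lemma Sigma_f_star:
  assumes "f 0 = 0" "is_star G c L"
  shows "Sigma_f f (degree_seq G) = f (card L) + real (card L) * f 1"
proof -
  have E: "edges G = (\<lambda>x. {c, x}) ` L" and "c \<notin> L" using assms(2) by (auto simp: is_star_def)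
  have "{e \<in> edges G. c \<in> e} = edges G" by (auto simp: E)
  then have c: "degree G c = card L" using is_star_card[OF assms(2)] by (simp add: degree_def)
  have "edge_weight f G {c, x} = quot f (card L) + quot f 1" if "x \<in> L" for x
  proof -
    have "{e \<in> edges G. x \<in> e} = {{c, x}}" using that \<open>c \<notin> L\<close> by (auto simp: E)
    then have "degree G x = 1" by (simp add: degree_def)
    moreover have "c \<noteq> x" using that \<open>c \<notin> L\<close> by auto
    ultimately show ?thesis using c by (simp add: edge_weight_def)
  qed
  then have "(\<Sum>e\<in>edges G. edge_weight f G e) = real (card L) * (quot f (card L) + quot f 1)"
    by (simp add: E sum.reindex[OF inj_on_doubleton])
  then show ?thesis
    using Sigma_f_eq_sum_edges[of f, OF assms(1) is_star_in_graphs[OF assms(2) refl]]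
      card_mult_quot_add[of f, OF assms(1)] by simp
qed

text \<open>The isomorphism is glued from three bijections: centre to centre, leaves to leaves,
  isolated vertices to isolated vertices.\<close>

lemma stars_isomorphic:
  assumes G: "is_star G c L" and H: "is_star H d M"
    and order: "order G = order H" and card: "card L = card M"
  shows "isomorphic G H"
proof -
  note G' = G[unfolded is_star_def] and H' = H[unfolded is_star_def]
  have fin: "finite (verts G)" "finite (verts H)" by (simp_all add: verts_def)
  then have finL: "finite L" "finite M" using G' H' by (meson finite_Diff finite_subset)+
  let ?R = "verts G - {c} - L" and ?S = "verts H - {d} - M"
  have "card ?R = card ?S"
    using G' H' fin finL order card by (simp add: card_Diff_subset verts_def)
  then obtain \<phi> \<psi> where "bij_betw \<phi> L M" "bij_betw \<psi> ?R ?S"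
    using finite_same_card_bij[OF finL card] finite_same_card_bij[of ?R ?S] fin by blast
  define \<pi> where "\<pi> v = (if v = c then d else if v \<in> L then \<phi> v else \<psi> v)" for v
  have L: "bij_betw \<pi> L M"
    using \<open>bij_betw \<phi> L M\<close> by (rule bij_betw_cong[THEN iffD1, rotated]) (use G' in \<open>auto simp: \<pi>_def\<close>)
  have R: "bij_betw \<pi> ?R ?S"
    using \<open>bij_betw \<psi> ?R ?S\<close> by (rule bij_betw_cong[THEN iffD1, rotated]) (auto simp: \<pi>_def)
  have c: "bij_betw \<pi> {c} {d}" by (simp add: \<pi>_def bij_betw_def)
  have "bij_betw \<pi> ({c} \<union> L \<union> ?R) ({d} \<union> M \<union> ?S)"
    by (intro bij_betw_combine c L R) (use H' in auto)
  moreover have "{c} \<union> L \<union> ?R = verts G" "{d} \<union> M \<union> ?S = verts H"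
    using G' H' by auto
  ultimately have bij: "bij_betw \<pi> (verts G) (verts H)" by simp
  \<comment> \<open>Edges must be reflected as well as preserved, so only \<open>c\<close> may go to
    \<open>d\<close> and only \<open>L\<close> into \<open>M\<close>.\<close>
  have \<pi>c: "\<pi> u = d \<longleftrightarrow> u = c" if "u \<in> verts G" for u
    using that bij G' by (metis \<pi>_def bij_betw_inv_into_left)
  have \<pi>L: "\<pi> u \<in> M \<longleftrightarrow> u \<in> L" if "u \<in> verts G" for u
  proof
    assume "\<pi> u \<in> M"
    then obtain x where "x \<in> L" "\<pi> x = \<pi> u" using L by (metis bij_betw_iff_bijections)
    then show "u \<in> L" using that bij G' by (metis Diff_iff bij_betw_inv_into_left subsetD)
  qed (use L in \<open>auto simp: bij_betw_def\<close>)
  have EG: "{u, v} \<in> edges G \<longleftrightarrow> u = c \<and> v \<in> L \<or> v = c \<and> u \<in> L" for u v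
    using G' by (auto simp: doubleton_eq_iff)
  have EH: "{u, v} \<in> edges H \<longleftrightarrow> u = d \<and> v \<in> M \<or> v = d \<and> u \<in> M" for u v
    using H' by (auto simp: doubleton_eq_iff)
  show ?thesis
    unfolding isomorphic_def by (rule exI[of _ \<pi>]) (use bij EG EH \<pi>c \<pi>L in auto)
qed

lemma obtain_star:
  assumes "G \<in> graphs n m" "n \<ge> 1" "c \<in> {1..n}" "\<And>e. e \<in> edges G \<Longrightarrow> c \<in> e"
  obtains L where "is_star G c L"
proof
  note G = graphsD[OF assms(1)]
  show "is_star G c {x. {c, x} \<in> edges G}"
    unfolding is_star_def
  proof (intro conjI equalityI subsetI)
    show "c \<in> verts G" using assms(3) by (simp add: G(1))
    show "x \<in> verts G - {c}" if "x \<in> {x. {c, x} \<in> edges G}" for x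
      using that G(4)[of "{c, x}"] G(5)[of "{c, x}"] by (auto simp: G(1))
    show "e \<in> (\<lambda>x. {c, x}) ` {x. {c, x} \<in> edges G}" if e: "e \<in> edges G" for e
    proof -
      obtain x where "e = {c, x}"
        using G(5)[OF e] assms(4)[OF e] by (auto simp: card_2_iff)
      then show ?thesis using e by auto
    qed
  qed auto
qed

text \<open>Edges of a graph attaining the bound pairwise meet. A triangle would give
  \<open>m = 3\<close> and \<open>f 3 = 3 * (f 2 - f 1)\<close>, which the last assumption
  excludes.\<close>

lemma maximizer_is_star:
  assumes "f \<in> class_F" "G \<in> graphs n m" "n \<ge> 1"
    and eq: "Sigma_f f (degree_seq G) = f m + real m * f 1"
    and "m \<noteq> 3 \<or> f 3 > 3 * (f 2 - f 1)"
  obtains c L where "is_star G c L"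
proof (cases "edges G = {}")
  case True
  then show thesis using obtain_star[OF assms(2,3), of 1] assms(3) that by auto
next
  case False
  note G = graphsD[OF assms(2)]
  have f0: "f 0 = 0" using assms(1) by (simp add: class_F_def)
  show thesis
  proof (rule intersecting_pairs_cases[of "edges G"])
    show "e \<inter> e' \<noteq> {}" if "e \<in> edges G" "e' \<in> edges G" for e e'
      using Sigma_f_le(2)[OF assms(1,2) eq that] .
  next
    fix c assume c: "\<And>e. e \<in> edges G \<Longrightarrow> c \<in> e"
    then have "c \<in> {1..n}" using False G(4) by blast
    then show thesis using obtain_star[OF assms(2,3) _ c] that by auto
  next
    fix a b c assume "distinct [a, b, c]" "edges G = {{a, b}, {b, c}, {a, c}}"
    from Sigma_f_triangle[of f, OF f0 assms(2) this] show thesis using eq assms(5) by auto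
  qed (use G False in auto)
qed

section \<open>The quasi-star\<close>

lemma qk_params_eqI:
  assumes "m = (q choose 2) + r" "r < q"
  shows "qk_params m = (q, r)"
  unfolding qk_params_def
  by (rule the1_equality[OF qk_params_unique]) (use assms in auto)

text \<open>For \<open>m > 0\<close> the complementary quasi-complete graph has
  \<open>q = n - 1\<close> and \<open>r = n - 1 - m\<close>, so the pairs it misses join
  \<open>n\<close> to the \<open>m\<close> vertices just before it.\<close>

lemma QS_is_star:
  assumes "n \<ge> 1" "m \<le> n - 1"
  shows "is_star (QS n m) n {n - m..<n}"
proof (cases "m = 0")
  case True
  \<comment> \<open>Here \<open>q = n - 1\<close> would give \<open>r = q\<close>, violating
    \<open>r < q\<close>; the graph is complete and \<open>q\<close> jumps to
    \<open>n\<close>.\<close>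
  then have "qk_params ((n choose 2) - m) = (n, 0)" using assms by (intro qk_params_eqI) auto
  then show ?thesis
    using assms True by (auto simp: QS_def QK_def complement_def is_star_def verts_def)
next
  case False
  define k where "k = n - 1"
  have k: "n = Suc k" "m \<le> k" "k - m < k" using assms False by (auto simp: k_def)
  have "(n choose 2) - m = (k choose 2) + (k - m)"
    using k by (simp add: numeral_2_eq_2)
  then have qk: "qk_params ((n choose 2) - m) = (k, k - m)"
    using k by (intro qk_params_eqI)
  have "pairs {1..n} - (pairs {1..k} \<union> {{i, k + 1} | i. i \<in> {1..k - m}})
      = (\<lambda>x. {n, x}) ` {n - m..<n}" (is "?A = ?B")
  proof (intro equalityI subsetI)
    fix e assume e: "e \<in> ?A"
    have "{1..n} = insert n {1..k}" by (auto simp: k(1))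
    then have sub: "e \<subseteq> insert n {1..k}" and "card e = 2" and "\<not> e \<subseteq> {1..k}"
      using e by (auto simp: pairs_def)
    then have "n \<in> e" by blast
    moreover obtain p q where "e = {p, q}" "p \<noteq> q"
      using \<open>card e = 2\<close> by (auto simp: card_2_iff)
    ultimately obtain x where x: "e = {n, x}" "x \<noteq> n" by blast
    then have "x \<in> {1..k}" using sub by blast
    moreover have "x \<notin> {1..k - m}"
    proof
      assume "x \<in> {1..k - m}"
      moreover have "e = {x, k + 1}" using x(1) k(1) by (simp add: insert_commute)
      ultimately show False using e by blast
    qed
    ultimately show "e \<in> ?B" using x k by auto
  next
    fix e assume "e \<in> ?B"
    then obtain x where x: "e = {n, x}" "n - m \<le> x" "x < n" by auto
    then show "e \<in> ?A" using k by (auto simp: pairs_def doubleton_eq_iff)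
  qed
  then have QS: "QS n m = Graph n ((\<lambda>x. {n, x}) ` {n - m..<n})"
    by (simp add: QS_def QK_def qk complement_def verts_def)
  show ?thesis
    unfolding QS is_star_def verts_def using k(1,2) by auto
qed

lemma order_QS: "order (QS n m) = n"
  by (simp add: QS_def QK_def complement_def split: prod.split)

text \<open>The second summand has no edges, and \<open>n \<ge> 3\<close> keeps the truncated
  subtraction exact, so the orders add up to \<open>n\<close>.\<close>

lemma triangle_graph:
  assumes "n \<ge> 3"
  defines "G \<equiv> disjoint_union (complete_graph 3) (complement (complete_graph (n - 3)))"
  shows "edges G = {{1, 2}, {2, 3}, {1, 3}}" "G \<in> graphs n 3"
proof -
  have "pairs {1, 2, 3} = {{1, 2}, {2, 3}, {1, 3}}"
  proof (intro equalityI subsetI)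
    fix e assume e: "e \<in> pairs {1, 2, 3}"
    then obtain p q where "e = {p, q}" "p \<noteq> q" by (auto simp: pairs_def card_2_iff)
    then show "e \<in> {{1, 2}, {2, 3}, {1, 3}}" using e by (auto simp: pairs_def)
  qed (auto simp: pairs_def)
  moreover have "{1..3} = {1, 2, 3::nat}" by auto
  ultimately have "pairs {1..3} = {{1, 2}, {2, 3}, {1, 3}}" by (simp only:)
  then show E: "edges G = {{1, 2}, {2, 3}, {1, 3}}"
    by (simp add: G_def disjoint_union_def complete_graph_def complement_def verts_def)
  have "order G = n"
    using assms(1) by (simp add: G_def disjoint_union_def complete_graph_def complement_def)
  then show "G \<in> graphs n 3"
    using assms(1) by (auto simp: graphs_def E verts_def pairs_def doubleton_eq_iff card_insert_if)
qed

theorem theorem5: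
  fixes f :: "nat \<Rightarrow> real"
  assumes "f \<in> class_F"
  shows "(\<forall>n m. n \<ge> 1 \<and> m \<le> n - 1 \<longrightarrow>
            maximizes f n m (QS n m) \<and>
            (m \<noteq> 3 \<or> f 3 > 3 * (f 2 - f 1) \<longrightarrow> uniquely_maximizes f n m (QS n m))) \<and>
         (f 3 = 3 * (f 2 - f 1) \<longrightarrow>
            (\<forall>n\<ge>4. maximizes f n 3 (disjoint_union (complete_graph 3) (complement (complete_graph (n - 3))))))"
proof -
  have f0: "f 0 = 0" using assms by (simp add: class_F_def)
  have maxI: "maximizes f n m G" if "G \<in> graphs n m" "Sigma_f f (degree_seq G) = f m + real m * f 1"
    for n m G
    using that Sigma_f_le(1)[OF assms] by (auto simp: maximizes_def)
  have "maximizes f n m (QS n m) \<and>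
      (m \<noteq> 3 \<or> f 3 > 3 * (f 2 - f 1) \<longrightarrow> uniquely_maximizes f n m (QS n m))"
    if nm: "n \<ge> 1" "m \<le> n - 1" for n m
  proof (intro conjI impI)
    note star = QS_is_star[OF nm]
    have "card {n - m..<n} = m" using nm by simp
    then have QS: "QS n m \<in> graphs n m" "Sigma_f f (degree_seq (QS n m)) = f m + real m * f 1"
      using is_star_in_graphs[OF star order_QS] Sigma_f_star[of f, OF f0 star] by simp_all
    then show max: "maximizes f n m (QS n m)" by (rule maxI)
    assume cond: "m \<noteq> 3 \<or> f 3 > 3 * (f 2 - f 1)"
    have "isomorphic (QS n m) H" if H: "maximizes f n m H" for H
    proof -
      have HG: "H \<in> graphs n m" using H by (simp add: maximizes_def)
      \<comment> \<open>The quasi-star attains the upper bound, so any other maximizer attains it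
        too and is a star.\<close>
      have "Sigma_f f (degree_seq (QS n m)) \<le> Sigma_f f (degree_seq H)"
        using H QS(1) by (simp add: maximizes_def)
      then have "Sigma_f f (degree_seq H) = f m + real m * f 1"
        using Sigma_f_le(1)[OF assms HG] QS(2) by simp
      then obtain c L where L: "is_star H c L"
        using maximizer_is_star[OF assms HG nm(1) _ cond] by blast
      show ?thesis
      proof (rule stars_isomorphic[OF star L])
        show "order (QS n m) = order H" using HG by (simp add: order_QS graphs_def)
        show "card {n - m..<n} = card L"
          using is_star_card[OF L] graphsD(2)[OF HG] \<open>card {n - m..<n} = m\<close> by simp
      qed
    qed
    then show "uniquely_maximizes f n m (QS n m)" using max by (simp add: uniquely_maximizes_def)
  qed
  moreover have "maximizes f n 3 (disjoint_union (complete_graph 3) (complement (complete_graph (n - 3))))"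
    if "f 3 = 3 * (f 2 - f 1)" "n \<ge> 4" for n
  proof (rule maxI)
    have "n \<ge> 3" using that by simp
    note G = triangle_graph[OF this]
    show "disjoint_union (complete_graph 3) (complement (complete_graph (n - 3))) \<in> graphs n 3"
      by (rule G)
    show "Sigma_f f (degree_seq (disjoint_union (complete_graph 3)
        (complement (complete_graph (n - 3))))) = f 3 + real 3 * f 1"
      using Sigma_f_triangle(2)[of f, OF f0 G(2) _ G(1)] that(1) by simp
  qed
  ultimately show ?thesis by blast
qed

end
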